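(* Let $k\ge 1$ be an integer and let $p_k$ denote the $k$th prime number. For every real $\lambda \ge 1.5/\log p_k$, every $k$-primitive set $A$ and every real $x\ge 2$, $$\sum_{\substack{n\in A\\ n\le x}} n^{-\lambda}\ \le\ \sum_{p\le x} p^{-\lambda},$$ where the sum on the right is over all primes $p\le x$.
   Context: A set $A\subset \mathbb{Z}_{>1}$ of integers greater than $1$ (finite or infinite) is called $k$-primitive if no member of $A$ divides any product of $j$ distinct other members of $A$, for any $1\le j\le k$. $\log$ is the natural logarithm. *)

theory Defs
  imports Complex_Main "HOL-Library.Infinite_Set" "HOL-Computational_Algebra.Primes"
begin

definition k_primitive :: "nat \<Rightarrow> nat set \<Rightarrow> bool" where
  "k_primitive k A \<longleftrightarrow>
     A \<subseteq> {1<..} \<and>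
     (\<forall>a\<in>A. \<forall>B. B \<subseteq> A - {a} \<and> finite B \<and> 1 \<le> card B \<and> card B \<le> k \<longrightarrow> \<not> a dvd \<Prod>B)"

(* Indexed from 1: the first prime is 2. The value at 0 is irrelevant. *)
definition nth_prime :: "nat \<Rightarrow> nat" where
  "nth_prime k = enumerate {p. prime p} (k - 1)"

end

theory Submission
  imports Defs "HOL-Library.Log_Nat"
begin

text \<open>
  The idea is to charge every \<open>n \<in> A\<close> to one of its prime factors \<open>p\<close> in such a way that the
  members charged to \<open>p\<close> have total weight at most \<open>p powr (- \<lambda>)\<close>. As \<open>p \<le> n\<close>, members up to
  \<open>x\<close> are charged to primes up to \<open>x\<close>, and summing over the primes gives the theorem.

  If \<open>n \<in> A\<close> is written as a product of at most \<open>k\<close> pairwise coprime parts, then one of the parts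
  divides no other member of \<open>A\<close> (lemma \<open>private_part_exists\<close>); call it private to \<open>n\<close>.
  Merging the two smallest parts of the prime power factorization again and again leads to at most
  \<open>k\<close> parts, each of which is a prime power or at most the \<open>2/(k+1)\<close>-th power of \<open>n\<close> (lemma
  \<open>balanced_coprime_factorization\<close>). So every \<open>n\<close> has a private divisor \<open>D\<close> that is a prime
  power or satisfies \<open>D ^ (k + 1) \<le> n\<^sup>2\<close>. It is charged to the largest prime factor of \<open>D\<close>.

  Private divisors of different members do not divide one another. Hence, if the divisor chosen for
  some member is a prime \<open>p\<close>, this is the only member charged to \<open>p\<close>. Otherwise at most one member
  with a private power \<open>p ^ e\<close>, \<open>e \<ge> 2\<close>, is charged to \<open>p\<close>, of weight at most
  \<open>p powr (- 2 \<lambda>)\<close>, and the others have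
  \<open>D = p * d\<close> with distinct \<open>d \<ge> 2\<close>. Their weights are at most \<open>(p * d) powr (- s)\<close> with
  \<open>s = \<lambda> (k + 1) / 2\<close>. For \<open>\<lambda> = (3/2) / ln p_k\<close> this exponent exceeds \<open>1\<close> sufficiently, although
  \<open>\<lambda>\<close> itself tends to \<open>0\<close>: it is at least \<open>11/6\<close>, which makes the sum over \<open>d\<close> at most \<open>1\<close>, and
  it eventually exceeds a multiple of \<open>1/\<lambda>\<close>, which makes the sum fit into the small room
  \<open>1 - p powr (- \<lambda>)\<close> that a private prime power leaves (lemmas \<open>local_bound\<close> and \<open>sum_fibre_le\<close>).

  Both bounds on \<open>s\<close> are upper bounds for \<open>p_k\<close> in terms of \<open>k\<close>. They follow from a
  Chebyshev-type estimate for large \<open>p_k\<close>, and from \<open>p_k \<le> (3/2) ^ (k + 1)\<close> for small ones.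
\<close>

section \<open>Private divisors of the members of a \<open>k\<close>-primitive set\<close>

text \<open>
  Private divisors of different members never divide one another, so members can be counted by
  their private divisors.
\<close>

definition private_divisor :: "nat set \<Rightarrow> nat \<Rightarrow> nat \<Rightarrow> bool" where
  "private_divisor A n d \<longleftrightarrow> d dvd n \<and> (\<forall>a\<in>A. d dvd a \<longrightarrow> a = n)"

lemma prod_coprime_dvd:
  fixes m :: nat
  assumes "finite F" "pairwise coprime F" "\<And>d. d \<in> F \<Longrightarrow> d dvd m"
  shows "\<Prod>F dvd m"
  using assms
proof (induction F rule: finite_induct)
  case (insert d F)
  have "coprime d (\<Prod>F)"
    using insert by (intro prod_coprime_right) (auto simp: pairwise_insert)
  with insert show ?case by (auto intro!: divides_mult simp: pairwise_insert)
qed simp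

text \<open>
  If every part had a multiple in \<open>A\<close> other than \<open>n\<close>, then \<open>n\<close>, as a product of
  coprime parts, would divide the product of the set of these multiples. Coprimality matters
  because one multiple may serve several parts; it then still is divisible by their product.
\<close>

lemma private_part_exists:
  assumes A: "k_primitive k A" "n \<in> A"
    and F: "finite F" "pairwise coprime F" "\<Prod>F = n" "card F \<le> k"
  obtains d where "d \<in> F" "private_divisor A n d"
proof -
  have "n > 1" using A by (auto simp: k_primitive_def)
  hence "F \<noteq> {}" using F(3) by auto
  have "\<exists>d\<in>F. private_divisor A n d"
  proof (rule ccontr)
    assume "\<not> ?thesis"
    moreover have "d dvd n" if "d \<in> F" for d
      using F(1,3) that by (metis dvd_prodI)
    ultimately have "\<forall>d\<in>F. \<exists>a\<in>A - {n}. d dvd a"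
      by (auto simp: private_divisor_def)
    then obtain g where g: "\<And>d. d \<in> F \<Longrightarrow> g d \<in> A - {n} \<and> d dvd g d"
      by metis
    have "\<Prod>F dvd \<Prod>(g ` F)"
    proof (rule prod_coprime_dvd[OF F(1,2)])
      fix d assume d: "d \<in> F"
      hence "g d dvd \<Prod>(g ` F)" using F(1) by (metis dvd_prodI finite_imageI imageI)
      thus "d dvd \<Prod>(g ` F)" using g d dvd_trans by blast
    qed
    moreover have "card (g ` F) \<le> k" using card_image_le[OF F(1), of g] F(4) by linarith
    moreover have "1 \<le> card (g ` F)" using F(1) \<open>F \<noteq> {}\<close>
      by (simp add: Suc_leI card_gt_0_iff)
    moreover have "g ` F \<subseteq> A - {n}" using g by blast
    ultimately show False using A F(1,3) unfolding k_primitive_def by blast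
  qed
  thus ?thesis using that by blast
qed

text \<open>
  Take the two smallest factors \<open>a \<le> b\<close>. Every other factor is at least \<open>b\<close>, so its square is
  at least \<open>a * b\<close>, and the square of the whole product is at least \<open>a * b\<close> to the power of the
  number of factors.
\<close>

lemma merge_two_smallest:
  fixes F :: "nat set"
  assumes F: "finite F" "\<And>d. d \<in> F \<Longrightarrow> d > 1" and card: "card F > k" "k \<ge> 1"
  obtains a b where "a \<in> F" "b \<in> F" "a \<noteq> b" "(a * b) ^ (k + 1) \<le> (\<Prod>F) ^ 2"
proof -
  define a where "a = Min F"
  have "F \<noteq> {}" using card by auto
  hence a: "a \<in> F" using F by (simp add: a_def)
  define G where "G = F - {a}"
  have cG: "card G = card F - 1" "finite G" using a F by (auto simp: G_def)
  hence "G \<noteq> {}" using card by auto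
  define b where "b = Min G"
  have b: "b \<in> G" using \<open>G \<noteq> {}\<close> cG by (simp add: b_def)
  define H where "H = G - {b}"
  have cH: "card H = card F - 2" "finite H" using b cG by (auto simp: H_def)
  have ab: "a \<le> b" using b F by (auto simp: a_def G_def)
  have pos: "a * b \<ge> 1" using a b F(2)[of a] F(2)[of b] by (auto simp: G_def Suc_le_eq)
  have prod: "\<Prod>F = a * (b * \<Prod>H)"
    using F a b cG by (simp add: prod.remove[of F a] prod.remove[of G b] G_def[symmetric] H_def[symmetric])
  have "b ^ card H \<le> \<Prod>H"
    using prod_mono[of H "\<lambda>_. b" "\<lambda>d. d"] cG by (auto simp: H_def b_def)
  have "(a * b) ^ card H \<le> (b * b) ^ card H" using ab by (intro power_mono) auto
  also have "\<dots> = (b ^ card H)\<^sup>2" by (simp add: power_mult_distrib power2_eq_square)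
  also have "\<dots> \<le> (\<Prod>H)\<^sup>2" using \<open>b ^ card H \<le> \<Prod>H\<close> by (intro power_mono) auto
  finally have H: "(a * b) ^ card H \<le> (\<Prod>H)\<^sup>2" .
  have "(a * b) ^ (k + 1) \<le> (a * b) ^ (2 + card H)"
    using pos card cH by (intro power_increasing) auto
  also have "\<dots> = (a * b)\<^sup>2 * (a * b) ^ card H" by (rule power_add)
  also have "\<dots> \<le> (a * b)\<^sup>2 * (\<Prod>H)\<^sup>2" using H by (intro mult_left_mono) auto
  also have "\<dots> = (\<Prod>F)\<^sup>2" unfolding prod by (simp add: power_mult_distrib mult_ac)
  finally show ?thesis using that a b by (auto simp: G_def)
qed

text \<open>
  Start with the maximal prime powers dividing \<open>n\<close> and keep merging the two smallest parts while
  there are more than \<open>k\<close> of them. A part is then either an original prime power or the result of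
  a merge, which is small. Choosing an admissible factorization with the fewest parts replaces the
  explicit iteration.
\<close>

lemma balanced_coprime_factorization:
  fixes n k :: nat
  assumes "n > 0" "k \<ge> 1"
  obtains F where "finite F" "pairwise coprime F" "\<Prod>F = n" "card F \<le> k"
    "\<And>d. d \<in> F \<Longrightarrow> d > 1"
    "\<And>d. d \<in> F \<Longrightarrow> (\<exists>q e. prime q \<and> d = q ^ e) \<or> d ^ (k + 1) \<le> n\<^sup>2"
proof -
  define good where "good F \<longleftrightarrow> finite F \<and> pairwise coprime F \<and> \<Prod>F = n \<and>
    (\<forall>d\<in>F. d > 1 \<and> ((\<exists>q e. prime q \<and> d = q ^ e) \<or> d ^ (k + 1) \<le> n\<^sup>2))" for F :: "nat set"
  have inj: "inj_on (\<lambda>p. p ^ multiplicity p n) (prime_factors n)"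
  proof (rule inj_onI)
    fix p q assume pq: "p \<in> prime_factors n" "q \<in> prime_factors n"
      "p ^ multiplicity p n = q ^ multiplicity q n"
    hence "p dvd q ^ multiplicity q n"
      by (metis dvd_power prime_factors_multiplicity mem_Collect_eq)
    thus "p = q" using pq
      by (metis in_prime_factors_imp_prime prime_dvd_power primes_dvd_imp_eq)
  qed
  have "good ((\<lambda>p. p ^ multiplicity p n) ` prime_factors n)"
    unfolding good_def
  proof (intro conjI ballI)
    show "pairwise coprime ((\<lambda>p. p ^ multiplicity p n) ` prime_factors n)"
      by (intro pairwise_imageI) (auto intro: primes_coprime simp: in_prime_factors_iff)
    show "\<Prod>((\<lambda>p. p ^ multiplicity p n) ` prime_factors n) = n"
      using inj prime_factorization_nat[of n] \<open>n > 0\<close> by (simp add: prod.reindex)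
    show "finite ((\<lambda>p. p ^ multiplicity p n) ` prime_factors n)" by simp
  next
    fix d assume "d \<in> (\<lambda>p. p ^ multiplicity p n) ` prime_factors n"
    then obtain p where "prime p" "multiplicity p n > 0" "d = p ^ multiplicity p n"
      by (auto simp: prime_factors_multiplicity)
    thus "d > 1" "(\<exists>q e. prime q \<and> d = q ^ e) \<or> d ^ (k + 1) \<le> n\<^sup>2"
      using one_less_power[OF prime_gt_1_nat] by auto
  qed
  then obtain F where F: "good F" and min: "\<And>G. good G \<Longrightarrow> card F \<le> card G"
    using arg_min_nat_lemma[of good _ card] by (metis)
  have "card F \<le> k"
  proof (rule ccontr)
    assume "\<not> card F \<le> k"
    then obtain a b where ab: "a \<in> F" "b \<in> F" "a \<noteq> b" "(a * b) ^ (k + 1) \<le> n\<^sup>2"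
      using merge_two_smallest[of F k] F \<open>k \<ge> 1\<close> by (auto simp: good_def)
    define H where "H = F - {a, b}"
    have cop: "coprime d c" if "d \<in> F" "c \<in> F" "d \<noteq> c" for c d
      using F that by (auto simp: good_def pairwise_def)
    have H: "finite H" "\<Prod>F = a * b * \<Prod>H" "card F = card H + 2"
    proof -
      have "F = insert a (insert b H)" "a \<notin> insert b H" "b \<notin> H" using ab by (auto simp: H_def)
      moreover show "finite H" using F by (simp add: H_def good_def)
      ultimately show "\<Prod>F = a * b * \<Prod>H" "card F = card H + 2" by (simp_all add: mult_ac)
    qed
    have gt: "a > 1" "b > 1" using F ab by (auto simp: good_def)
    have "a * b \<notin> H"
    proof
      assume "a * b \<in> H"
      hence "coprime (a * b) a" using cop[of "a * b" a] ab by (auto simp: H_def)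
      thus False using gt by simp
    qed
    have "good (insert (a * b) H)"
      unfolding good_def
    proof (intro conjI ballI)
      show "pairwise coprime (insert (a * b) H)"
        using F cop ab by (auto simp: H_def good_def pairwise_def)
      show "\<Prod>(insert (a * b) H) = n" using H \<open>a * b \<notin> H\<close> F by (simp add: good_def)
    next
      fix d assume d: "d \<in> insert (a * b) H"
      show "d > 1" using d F gt by (auto simp: H_def good_def less_1_mult simp del: One_nat_def)
      show "(\<exists>q e. prime q \<and> d = q ^ e) \<or> d ^ (k + 1) \<le> n\<^sup>2"
        using d F ab by (auto simp: H_def good_def)
    qed (use H in simp)
    from min[OF this] H \<open>a * b \<notin> H\<close> show False by simp
  qed
  with F that show ?thesis by (auto simp: good_def)
qed

lemma private_divisor_prime_power_or_small:
  assumes "k_primitive k A" "n \<in> A" "k \<ge> 1"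
  obtains d where "d > 1" "private_divisor A n d"
    "(\<exists>q e. prime q \<and> d = q ^ e) \<or> d ^ (k + 1) \<le> n\<^sup>2"
proof -
  have "n > 0" using assms by (auto simp: k_primitive_def)
  then obtain F where F: "finite F" "pairwise coprime F" "\<Prod>F = n" "card F \<le> k"
    "\<And>d. d \<in> F \<Longrightarrow> d > 1"
    "\<And>d. d \<in> F \<Longrightarrow> (\<exists>q e. prime q \<and> d = q ^ e) \<or> d ^ (k + 1) \<le> n\<^sup>2"
    using balanced_coprime_factorization[of n k] assms(3) by metis
  thus ?thesis using private_part_exists[OF assms(1,2) F(1-4)] that by metis
qed

section \<open>The size of the \<open>k\<close>-th prime\<close>

text \<open>
  The numbers \<open>1 / (m (n choose m))\<close> form Leibniz' harmonic triangle: each entry in column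
  \<open>m + 1\<close> is a difference of two entries in column \<open>m\<close>, and column \<open>1\<close> consists of the
  reciprocals \<open>1/n\<close>. So every entry up to row \<open>N\<close> is an integer combination of
  \<open>1/1, \<dots>, 1/N\<close>, and multiplying by a common multiple of \<open>1, \<dots>, N\<close> makes it an integer.
\<close>

lemma leibniz_triangle_dvd:
  fixes M N m n :: nat
  assumes M: "\<And>j. 1 \<le> j \<Longrightarrow> j \<le> N \<Longrightarrow> j dvd M" and m: "1 \<le> m" "m \<le> n" "n \<le> N"
  shows "m * (n choose m) dvd M"
proof -
  have "real M / real (m * (n choose m)) \<in> \<int>"
    using m
  proof (induction m arbitrary: n rule: dec_induct)
    case base
    then obtain c where "M = n * c" using M[of n] by (auto elim: dvdE)
    thus ?case using base by simp
  next
    case (step m)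
    define c where "c = (n - 1 choose m)"
    have c: "c > 0" using step by (simp add: c_def)
    have "(n - m) * (n choose m) = n * c"
      unfolding c_def by (rule binomial_absorb_comp)
    hence nm: "real (n choose m) = real n * real c / (real n - real m)"
      using step.prems of_nat_diff[of m n, where 'a = real]
      by (simp add: field_simps flip: of_nat_mult of_nat_diff)
    have Sm: "Suc m * (n choose Suc m) = n * c"
      using binomial_absorption[of m n] by (simp only: c_def)
    have "real M / real (Suc m * (n choose Suc m)) = real M / (real n * real c)"
      unfolding Sm by simp
    also have "\<dots> = real M / real (m * (n - 1 choose m)) - real M / real (m * (n choose m))"
    proof -
      have "real m > 0" "real n > 0" "real n - real m > 0" "real c > 0"
        using step.hyps step.prems c by auto
      thus ?thesis
        unfolding c_def[symmetric] of_nat_mult nm by (simp add: field_simps)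
    qed
    also have "\<dots> \<in> \<int>"
      using step.IH[of "n - 1"] step.IH[of n] step.prems by (intro Ints_diff) auto
    finally show ?case .
  qed
  then obtain i where "real M / real (m * (n choose m)) = of_int i" by (elim Ints_cases)
  moreover have "m * (n choose m) > 0" using m by simp
  ultimately have "real M = of_int i * real (m * (n choose m))"
    by (simp add: field_simps)
  hence "int M = i * int (m * (n choose m))"
    by (metis of_int_eq_iff of_int_mult of_int_of_nat_eq)
  thus ?thesis by (metis dvd_triv_right int_dvd_int_iff)
qed

text \<open>
  The witness is the least common multiple of \<open>1, \<dots>, N\<close>, written as the product of the
  largest powers \<open>q ^ e \<le> N\<close> of the primes \<open>q \<le> N\<close>.
\<close>

lemma common_multiple_le_power_prime_count:
  fixes N :: nat
  assumes "N > 0"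
  obtains M where "M > 0" "\<And>j. 1 \<le> j \<Longrightarrow> j \<le> N \<Longrightarrow> j dvd M"
    "M \<le> N ^ card {q. prime q \<and> q \<le> N}"
proof -
  define P where "P = {q. prime q \<and> q \<le> N}"
  define e where "e q = floorlog q N - 1" for q
  have fin: "finite P" by (simp add: P_def)
  have e: "q ^ e q \<le> N" "N < q ^ (e q + 1)" if "q \<in> P" for q
  proof -
    have "q > 1" using that prime_gt_1_nat by (auto simp: P_def)
    thus "q ^ e q \<le> N" "N < q ^ (e q + 1)"
      using floorlog_bounds[of N q] \<open>N > 0\<close> by (cases "floorlog q N"; simp add: e_def)+
  qed
  show ?thesis
  proof (rule that[of "\<Prod>q\<in>P. q ^ e q"])
    show "(\<Prod>q\<in>P. q ^ e q) > 0" by (intro prod_pos) (auto simp: P_def prime_gt_0_nat)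
    have "(\<Prod>q\<in>P. q ^ e q) \<le> (\<Prod>q\<in>P. N)" using e(1) by (intro prod_mono) auto
    thus "(\<Prod>q\<in>P. q ^ e q) \<le> N ^ card {q. prime q \<and> q \<le> N}" by (simp add: P_def)
  next
    fix j assume j: "1 \<le> j" "j \<le> N"
    have sub: "prime_factors j \<subseteq> P"
      using j by (auto simp: P_def in_prime_factors_iff intro: order_trans[OF dvd_imp_le])
    have "j = (\<Prod>q\<in>prime_factors j. q ^ multiplicity q j)"
      using j by (intro prime_factorization_nat) simp
    also have "\<dots> dvd (\<Prod>q\<in>prime_factors j. q ^ e q)"
    proof (intro prod_dvd_prod le_imp_power_dvd)
      fix q assume q: "q \<in> prime_factors j"
      have "q ^ multiplicity q j \<le> j" using j by (intro dvd_imp_le multiplicity_dvd) simp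
      also have "\<dots> < q ^ (e q + 1)" using j e(2)[of q] q sub by fastforce
      finally have "multiplicity q j < e q + 1"
        using q prime_gt_1_nat[of q] by (subst (asm) power_strict_increasing_iff) auto
      thus "multiplicity q j \<le> e q" by simp
    qed
    also have "\<dots> dvd (\<Prod>q\<in>P. q ^ e q)" using sub fin by (intro prod_dvd_prod_subset)
    finally show "j dvd (\<Prod>q\<in>P. q ^ e q)" .
  qed
qed

text \<open>
  Chebyshev's lower bound for the number of primes: the common multiple above is at least
  \<open>m (2m choose m)\<close>, which is at least half of \<open>4 ^ m\<close>.
\<close>

lemma chebyshev_lower_bound:
  fixes m :: nat
  assumes "m \<ge> 1"
  shows "4 ^ m \<le> 2 * (2 * m) ^ card {q. prime q \<and> q \<le> 2 * m}"
proof -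
  obtain M where M: "M > 0" "\<And>j. 1 \<le> j \<Longrightarrow> j \<le> 2 * m \<Longrightarrow> j dvd M"
    "M \<le> (2 * m) ^ card {q. prime q \<and> q \<le> 2 * m}"
    using common_multiple_le_power_prime_count[of "2 * m"] assms by auto
  have "m * (2 * m choose m) \<le> M"
    using leibniz_triangle_dvd[OF M(2), where m = m] M(1) assms by (intro dvd_imp_le) auto
  moreover have "4 ^ m \<le> 2 * (m * (2 * m choose m))"
  proof -
    have "real (4 ^ m) \<le> real (2 * (m * (2 * m choose m)))"
      using central_binomial_lower_bound[of m] assms by (simp add: field_simps)
    thus ?thesis by (simp only: of_nat_le_iff)
  qed
  ultimately show ?thesis using M(3) by linarith
qed

lemma prime_nth_prime: "prime (nth_prime k)"
  unfolding nth_prime_def using enumerate_in_set[OF primes_infinite, of "k - 1"] by simp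

lemma card_primes_less_nth_prime: "card {q. prime q \<and> q < nth_prime k} = k - 1"
proof -
  let ?P = "{p::nat. prime p}"
  have "{q. prime q \<and> q < nth_prime k} = enumerate ?P ` {..<k - 1}"
  proof (intro equalityI subsetI)
    fix q assume q: "q \<in> {q. prime q \<and> q < nth_prime k}"
    then obtain i where i: "enumerate ?P i = q"
      using enumerate_Ex[OF primes_infinite] by blast
    hence "i < k - 1" using q primes_infinite by (auto simp: nth_prime_def)
    thus "q \<in> enumerate ?P ` {..<k - 1}" using i by blast
  next
    fix q assume "q \<in> enumerate ?P ` {..<k - 1}"
    thus "q \<in> {q. prime q \<and> q < nth_prime k}"
      using enumerate_in_set[OF primes_infinite] primes_infinite by (auto simp: nth_prime_def)
  qed
  moreover have "inj_on (enumerate ?P) {..<k - 1}"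
    using inj_enumerate[OF primes_infinite] by (rule inj_on_subset) simp
  ultimately show ?thesis by (simp add: card_image)
qed

lemma nth_prime_le:
  assumes "Q \<subseteq> {q. prime q \<and> q \<le> b}" "card Q \<ge> k" "k \<ge> 1"
  shows "nth_prime k \<le> b"
proof (rule ccontr)
  assume "\<not> ?thesis"
  hence "Q \<subseteq> {q. prime q \<and> q < nth_prime k}" using assms by auto
  hence "card Q \<le> k - 1" using card_mono[of "{q. prime q \<and> q < nth_prime k}" Q]
    by (simp add: card_primes_less_nth_prime)
  with assms show False by simp
qed

text \<open>
  The third prime is the tight case, with \<open>5 < (3/2)^4 = 5.0625\<close>. Only the first eleven primes
  need to be inspected, since \<open>(3/2)^13 > 194\<close>.
\<close>

lemma nth_prime_le_power:
  assumes k: "k \<ge> 1" and small: "nth_prime k \<le> 194"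
  shows "real (nth_prime k) \<le> (3 / 2) ^ (k + 1)"
proof (cases "k \<le> 11")
  case False
  have "real (nth_prime k) \<le> (3 / 2) ^ 13" using small by (simp add: power_divide)
  also have "\<dots> \<le> (3 / 2) ^ (k + 1)" using False by (intro power_increasing) auto
  finally show ?thesis .
next
  case True
  have bound: "real (nth_prime j) \<le> (3 / 2) ^ (j + 1)"
    if "Q \<subseteq> {q. prime q \<and> q \<le> b}" "card Q \<ge> j" "j \<ge> 1" "real b \<le> (3 / 2) ^ (j + 1)"
    for Q b j
    using nth_prime_le[OF that(1-3)] that(4) by linarith
  from True k consider "k = 1" | "k = 2" | "k = 3" | "k = 4" | "k = 5" | "k = 6" | "k = 7"
    | "k = 8" | "k = 9" | "k = 10" | "k = 11" by atomize_elim presburger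
  thus ?thesis
  proof cases
    case 1 thus ?thesis using bound[of "{2}" 2 k] by (simp add: power_divide)
  next
    case 2 thus ?thesis using bound[of "{2,3}" 3 k] by (simp add: power_divide)
  next
    case 3 thus ?thesis using bound[of "{2,3,5}" 5 k] by (simp add: power_divide)
  next
    case 4 thus ?thesis using bound[of "{2,3,5,7}" 7 k] by (simp add: power_divide)
  next
    case 5 thus ?thesis using bound[of "{2,3,5,7,11}" 11 k] by (simp add: power_divide)
  next
    case 6 thus ?thesis using bound[of "{2,3,5,7,11,13}" 13 k] by (simp add: power_divide)
  next
    case 7 thus ?thesis using bound[of "{2,3,5,7,11,13,17}" 17 k] by (simp add: power_divide)
  next
    case 8 thus ?thesis using bound[of "{2,3,5,7,11,13,17,19}" 19 k] by (simp add: power_divide)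
  next
    case 9 thus ?thesis using bound[of "{2,3,5,7,11,13,17,19,23}" 23 k] by (simp add: power_divide)
  next
    case 10 thus ?thesis using bound[of "{2,3,5,7,11,13,17,19,23,29}" 29 k] by (simp add: power_divide)
  next
    case 11 thus ?thesis using bound[of "{2,3,5,7,11,13,17,19,23,29,31}" 31 k] by (simp add: power_divide)
  qed
qed

lemma exp_one_ge: "exp 1 \<ge> (27 / 10 :: real)"
proof -
  \<comment> \<open>\<open>85/72 = 1 + 1/6 + 1/72\<close> is the quadratic Taylor polynomial of \<open>exp\<close> at \<open>1/6\<close>.\<close>
  have "(27 / 10 :: real) \<le> (85 / 72) ^ 6" by (simp add: power_divide)
  also have "\<dots> \<le> exp (1 / 6) ^ 6"
    using exp_lower_Taylor_quadratic[of "1 / 6 :: real"]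
    by (intro power_mono) (auto simp: power2_eq_square)
  also have "\<dots> = exp 1" by (simp flip: exp_of_nat_mult)
  finally show ?thesis .
qed

lemma exp_ge_27_10_mult: "exp (y::real) \<ge> 27 / 10 * y"
proof (cases "y \<ge> 0")
  case True
  have "27 / 10 * y \<le> exp 1 * y" using exp_one_ge True by (intro mult_right_mono) auto
  also have "\<dots> \<le> exp 1 * exp (y - 1)" using exp_ge_add_one_self[of "y - 1"] by simp
  finally show ?thesis by (simp flip: exp_add)
next
  case False
  thus ?thesis by (meson exp_gt_zero less_eq_real_def mult_nonneg_nonpos not_le order_trans
      zero_le_divide_iff zero_le_numeral linorder_linear)
qed

lemma ln_two_ge: "ln 2 \<ge> (3 / 5 :: real)"
proof -
  have "exp (3 / 5 :: real) ^ 5 = exp 1 ^ 3" by (simp flip: exp_of_nat_mult)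
  also have "\<dots> \<le> 3 ^ 3" using exp_le by (intro power_mono) auto
  also have "\<dots> \<le> (2 ^ 5 :: real)" by simp
  finally have "exp (3 / 5 :: real) \<le> 2" by (rule power_le_imp_le_base[where n = 4, simplified]) simp
  thus ?thesis by (subst ln_ge_iff) auto
qed

text \<open>
  Chebyshev's bound for the even number \<open>p_k - 1\<close>, up to which there are \<open>k - 1\<close> primes, gives
  \<open>(p_k - 2) ln 2 \<le> (k - 1) ln p_k\<close>. It therefore suffices that \<open>(ln p)^3\<close> is at most about
  \<open>(9/10) p\<close>, which \<open>exp y \<ge> (27/10) y\<close> at \<open>y = (ln p) / 6\<close> yields for \<open>p \<ge> 195\<close>.
\<close>

lemma ln_nth_prime_squared_le:
  assumes k: "k \<ge> 1" and large: "nth_prime k \<ge> 195"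
  shows "(ln (real (nth_prime k)))\<^sup>2 \<le> 3 / 2 * (real k + 1)"
proof -
  define p where "p = nth_prime k"
  define L where "L = ln (real p)"
  have p: "prime p" "p \<ge> 195" using prime_nth_prime large by (simp_all add: p_def)
  hence "odd p" by (intro prime_odd_nat) auto
  then obtain m where m: "p = 2 * m + 1" by (elim oddE)
  have "{q. prime q \<and> q \<le> 2 * m} = {q. prime q \<and> q < nth_prime k}"
    using m by (auto simp: p_def)
  hence "4 ^ m \<le> 2 * (2 * m) ^ (k - 1)"
    using chebyshev_lower_bound[of m] m p card_primes_less_nth_prime[of k] by simp
  also have "\<dots> \<le> 2 * p ^ (k - 1)" using m by (intro mult_left_mono power_mono) auto
  finally have "real (4 ^ m) \<le> real (2 * p ^ (k - 1))" by (simp only: of_nat_le_iff)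
  hence "ln (real (4 ^ m)) \<le> ln (real (2 * p ^ (k - 1)))" using p by simp
  hence "(2 * real m - 1) * ln 2 \<le> (real k - 1) * L"
    using p k ln_realpow[of 2 2] by (simp add: ln_mult ln_realpow L_def of_nat_diff algebra_simps)
  hence lower: "(real p - 2) * ln 2 \<le> (real k - 1) * L" using m by simp
  have "L > 0" using p by (simp add: L_def)
  define w where "w = exp (L / 2)"
  have pw: "real p = w\<^sup>2"
    using p by (simp add: w_def L_def flip: exp_of_nat_mult)
  have w: "w \<ge> 13"
  proof (rule ccontr)
    assume "\<not> w \<ge> 13"
    hence "w\<^sup>2 \<le> 13\<^sup>2" by (intro power_mono) (auto simp: w_def)
    thus False using pw p by simp
  qed
  have "(27 / 10 * (L / 6)) ^ 3 \<le> exp (L / 6) ^ 3"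
    using exp_ge_27_10_mult[of "L / 6"] \<open>L > 0\<close> by (intro power_mono) auto
  also have "\<dots> = w" by (simp add: w_def flip: exp_of_nat_mult)
  finally have "L ^ 3 \<le> 11 * w" using w by (simp add: power_divide power_mult_distrib)
  also have "11 * w \<le> 9 / 10 * (w\<^sup>2 - 2)"
  proof -
    have "(w - 13) * w \<ge> 0" using w by simp
    moreover have "w\<^sup>2 \<ge> 195" using p pw by linarith
    ultimately show ?thesis by (simp add: power2_eq_square algebra_simps)
  qed
  also have "\<dots> \<le> 3 / 2 * ((real p - 2) * ln 2)"
    using mult_left_mono[OF ln_two_ge, of "real p - 2"] p pw by simp
  also have "\<dots> \<le> 3 / 2 * ((real k + 1) * L)"
    using lower \<open>L > 0\<close> by (simp add: algebra_simps)
  finally have "L * L\<^sup>2 \<le> L * (3 / 2 * (real k + 1))"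
    by (simp add: power3_eq_cube power2_eq_square mult_ac)
  thus ?thesis using \<open>L > 0\<close> by (simp add: L_def p_def)
qed

text \<open>
  The constant is the one for which \<open>tail_exponent k\<close> below is at least \<open>11/6\<close>.
  For primes up to \<open>194\<close> it comes from \<open>ln (3/2) \<le> 9/22\<close>.
\<close>

lemma ln_nth_prime_le:
  assumes "k \<ge> 1"
  shows "ln (real (nth_prime k)) \<le> 9 / 22 * (real k + 1)"
proof (cases "nth_prime k \<le> 194")
  case True
  have "(3 / 2 :: real) \<le> exp (9 / 22)"
  proof -
    \<comment> \<open>\<open>4745/3872\<close> is the quadratic Taylor polynomial of \<open>exp\<close> at \<open>9/44\<close>.\<close>
    have "(3 / 2 :: real) \<le> (4745 / 3872) ^ 2" by (simp add: power2_eq_square)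
    also have "\<dots> \<le> exp (9 / 44) ^ 2"
      using exp_lower_Taylor_quadratic[of "9 / 44 :: real"]
      by (intro power_mono) (auto simp: power2_eq_square)
    finally show ?thesis by (simp flip: exp_of_nat_mult)
  qed
  hence "ln (3 / 2 :: real) \<le> 9 / 22" by (metis exp_gt_zero ln_exp ln_le_cancel_iff zero_less_divide_iff zero_less_numeral)
  hence "(real k + 1) * ln (3 / 2) \<le> (real k + 1) * (9 / 22)" by (intro mult_left_mono) auto
  moreover have "ln (real (nth_prime k)) \<le> ln ((3 / 2) ^ (k + 1))"
    using nth_prime_le_power[OF assms True] prime_gt_0_nat[OF prime_nth_prime[of k]] by simp
  moreover have "ln ((3 / 2 :: real) ^ (k + 1)) = (real k + 1) * ln (3 / 2)"
    by (subst ln_realpow) auto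
  ultimately show ?thesis by (simp add: mult_ac)
next
  case False
  define L where "L = ln (real (nth_prime k))"
  have "exp 4 = exp (1::real) ^ 4" by (simp flip: exp_of_nat_mult)
  also have "\<dots> \<le> 3 ^ 4" using exp_le by (intro power_mono) auto
  also have "\<dots> \<le> real (nth_prime k)" using False by simp
  finally have "L \<ge> 4" using False by (simp add: L_def ln_ge_iff)
  hence "L * L \<ge> 4 * L" by (intro mult_right_mono) auto
  moreover have "L * L \<le> 3 / 2 * (real k + 1)"
    using ln_nth_prime_squared_le[OF assms] False by (simp add: L_def power2_eq_square)
  ultimately have "L \<le> 9 / 22 * (real k + 1)" by (simp add: field_simps)
  thus ?thesis by (simp add: L_def)
qed

section \<open>Power sums over integers from 2 on\<close>

text \<open>
  A discrete form of comparing the summand with the integral of \<open>t powr (- c)\<close> from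
  \<open>d - 1\<close> to \<open>d\<close>, obtained from \<open>ln (1 - 1/d) \<le> - 1/d\<close>.
\<close>

lemma powr_le_telescoping:
  fixes c :: real
  assumes "c > 1" "d \<ge> 2"
  shows "real d powr (- c) \<le> (real (d - 1) powr (1 - c) - real d powr (1 - c)) / (c - 1)"
proof -
  have d: "real (d - 1) = real d * (1 - 1 / real d)" "0 < 1 - 1 / real d"
    using assms by (simp_all add: of_nat_diff field_simps)
  have "(c - 1) * (1 / real d) \<le> (1 - c) * ln (1 - 1 / real d)"
    using mult_left_mono[OF ln_add_one_self_le_self2[of "- (1 / real d)"], of "c - 1"] assms d
    by (simp add: algebra_simps)
  hence "1 + (c - 1) * (1 / real d) \<le> exp ((1 - c) * ln (1 - 1 / real d))"
    using exp_ge_add_one_self[of "(1 - c) * ln (1 - 1 / real d)"] by linarith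
  also have "\<dots> = (1 - 1 / real d) powr (1 - c)"
    using d(2) by (simp only: powr_def less_imp_neq[symmetric] if_False)
  finally have "real d powr (1 - c) * (1 + (c - 1) * (1 / real d))
      \<le> real d powr (1 - c) * (1 - 1 / real d) powr (1 - c)" by (intro mult_left_mono) auto
  also have "\<dots> = real (d - 1) powr (1 - c)" using d by (simp add: powr_mult)
  finally have "(c - 1) * (real d powr (1 - c) / real d) \<le> real (d - 1) powr (1 - c) - real d powr (1 - c)"
    by (simp add: algebra_simps)
  moreover have "real d powr (1 - c) / real d = real d powr (- c)"
    using assms by (simp add: powr_diff powr_minus field_simps)
  ultimately show ?thesis using assms by (simp add: field_simps)
qed

text \<open>
  The term \<open>d = 2\<close> is kept and only the later ones are telescoped; telescoping from \<open>d = 2\<close> on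
  would give \<open>1 / (c - 1)\<close>, which exceeds \<open>1\<close> for the exponents near \<open>11/6\<close> that occur below.
\<close>

lemma sum_powr_tail_le:
  fixes c :: real
  assumes c: "c > 1" and T: "finite T" "T \<subseteq> {2..}"
  shows "(\<Sum>d\<in>T. real d powr (- c)) \<le> 2 powr (- c) * ((c + 1) / (c - 1))"
proof -
  define g where "g d = real d powr (1 - c)" for d :: nat
  define N where "N = Max (insert 2 T)"
  have N: "N \<ge> 2" "T \<subseteq> {2..N}" using T by (auto simp: N_def)
  have tele: "(\<Sum>d\<in>{3..N}. g (d - 1) - g d) = g 2 - g N"
    using N(1) by (induction N rule: dec_induct) (auto simp: numeral_3_eq_3)
  have "(\<Sum>d\<in>T. real d powr (- c)) \<le> (\<Sum>d\<in>{2..N}. real d powr (- c))"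
    using N by (intro sum_mono2) auto
  also have "\<dots> = 2 powr (- c) + (\<Sum>d\<in>{3..N}. real d powr (- c))"
    using N by (subst sum.atLeast_Suc_atMost) auto
  also have "(\<Sum>d\<in>{3..N}. real d powr (- c)) \<le> (\<Sum>d\<in>{3..N}. (g (d - 1) - g d) / (c - 1))"
    unfolding g_def using c by (intro sum_mono powr_le_telescoping) auto
  also have "\<dots> = (g 2 - g N) / (c - 1)" by (simp only: tele flip: sum_divide_distrib)
  also have "\<dots> \<le> g 2 / (c - 1)" using c by (intro divide_right_mono) (auto simp: g_def)
  also have "2 powr (- c) + g 2 / (c - 1) = 2 powr (- c) * ((c + 1) / (c - 1))"
  proof -
    have "g 2 = 2 * 2 powr (- c)" by (simp add: g_def powr_diff powr_minus field_simps)
    thus ?thesis using c by (simp add: field_simps)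
  qed
  finally show ?thesis by simp
qed

lemma le_powr_of_power_le:
  fixes a b :: real
  assumes "b > 0" "n > 0" "a ^ n \<le> b ^ m"
  shows "a \<le> b powr (real m / real n)"
proof (rule power_le_imp_le_base[where n = "n - 1"])
  have "(b powr (real m / real n)) ^ n = b ^ m"
    using assms by (simp add: powr_power powr_realpow)
  thus "a ^ Suc (n - 1) \<le> (b powr (real m / real n)) ^ Suc (n - 1)" using assms by simp
qed simp

lemma sum_powr_tail_le_one:
  assumes "s \<ge> 11 / 6" "finite T" "T \<subseteq> {2..}"
  shows "(\<Sum>d\<in>T. real d powr (- s)) \<le> 1"
proof -
  have "(\<Sum>d\<in>T. real d powr (- s)) \<le> (\<Sum>d\<in>T. real d powr (- (11 / 6)))"
    using assms by (intro sum_mono powr_mono) (auto simp: subset_eq Suc_le_eq)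
  also have "\<dots> \<le> 2 powr (- (11 / 6)) * (17 / 5)"
    using sum_powr_tail_le[of "11 / 6" T] assms by simp
  also have "\<dots> \<le> 1"
  proof -
    have "(17 / 5 :: real) \<le> 2 powr (11 / 6)"
      using le_powr_of_power_le[of 2 6 "17 / 5" 11] by (simp add: power_divide)
    thus ?thesis by (simp add: powr_minus field_simps)
  qed
  finally show ?thesis .
qed

lemma sum_powr_tail_le_three_quarters:
  assumes "s \<ge> 2" "finite T" "T \<subseteq> {2..}"
  shows "(\<Sum>d\<in>T. real d powr (- s)) \<le> 3 / 4"
proof -
  have "(\<Sum>d\<in>T. real d powr (- s)) \<le> (\<Sum>d\<in>T. real d powr (- 2))"
    using assms by (intro sum_mono powr_mono) (auto simp: subset_eq Suc_le_eq)
  also have "\<dots> \<le> 3 / 4"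
    using sum_powr_tail_le[of 2 T] assms by (simp add: powr_minus)
  finally show ?thesis .
qed

section \<open>The exponents and the inequality at a single prime\<close>

text \<open>
  The least admissible exponent. All local estimates are made for this value of
  \<open>\<lambda>\<close>; larger values follow by monotonicity.
\<close>

definition critical_exponent_bound :: "nat \<Rightarrow> real" where
  "critical_exponent_bound k = (3 / 2) / ln (real (nth_prime k))"

text \<open>
  If \<open>D ^ (k + 1) \<le> n\<^sup>2\<close>, then \<open>n powr (- l) \<le> D powr (- s)\<close> where \<open>l\<close> is the
  exponent above and \<open>s\<close> this one.
\<close>

definition tail_exponent :: "nat \<Rightarrow> real" where
  "tail_exponent k = critical_exponent_bound k * (real k + 1) / 2"

lemma nth_prime_one: "nth_prime 1 = 2"
proof (rule antisym)
  show "nth_prime 1 \<le> 2" by (rule nth_prime_le[of "{2}"]) auto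
  show "nth_prime 1 \<ge> 2" by (rule prime_ge_2_nat[OF prime_nth_prime])
qed

lemma nth_prime_ge_three:
  assumes "k \<ge> 2"
  shows "nth_prime k \<ge> 3"
proof (rule ccontr)
  assume "\<not> ?thesis"
  hence "nth_prime k = 2" using prime_ge_2_nat[OF prime_nth_prime[of k]] by linarith
  hence "{q. prime q \<and> q < nth_prime k} = {}" by (auto dest: prime_ge_2_nat)
  hence "card {q. prime q \<and> q < nth_prime k} = 0" by (simp only: card.empty)
  thus False using card_primes_less_nth_prime[of k] assms by linarith
qed

lemma ln_nth_prime_pos: "ln (real (nth_prime k)) > 0"
  using prime_gt_1_nat[OF prime_nth_prime[of k]] by (intro ln_gt_zero) simp

lemma critical_exponent_bound_pos: "critical_exponent_bound k > 0"
  using ln_nth_prime_pos by (simp add: critical_exponent_bound_def)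

lemma tail_exponent_ge:
  assumes "k \<ge> 1"
  shows "tail_exponent k \<ge> 11 / 6" "tail_exponent k \<ge> critical_exponent_bound k"
proof -
  show "tail_exponent k \<ge> 11 / 6"
    using ln_nth_prime_le[OF assms] ln_nth_prime_pos[of k]
    by (simp add: tail_exponent_def critical_exponent_bound_def field_simps)
  show "tail_exponent k \<ge> critical_exponent_bound k"
    using mult_left_mono[of 1 "(real k + 1) / 2" "critical_exponent_bound k"] assms
      critical_exponent_bound_pos[of k] by (simp add: tail_exponent_def)
qed

text \<open>
  With \<open>v = 3 powr l\<close> the claim reads \<open>1/v + v * 3 powr (- s) \<le> 1\<close>. As
  \<open>3 powr s \<ge> 3 powr (11/6) \<ge> 36/5\<close>, it follows from a quadratic inequality in \<open>v\<close> that holds between the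
  roots \<open>6/5\<close> and \<open>6\<close> of \<open>v\<^sup>2 - (36/5) v + 36/5\<close>. The value never exceeds \<open>6\<close>, but it tends to
  \<open>1\<close> as \<open>k\<close> grows. When it is below \<open>6/5\<close>, the prime \<open>p_k\<close> is so large that \<open>s * l \<ge> 3/4\<close>;
  then \<open>s\<close> is at least a multiple of \<open>1/l\<close>, which makes \<open>v * 3 powr (- s)\<close> smaller than the gap
  \<open>1 - 1/v\<close>, whose size is of the order of \<open>l\<close>.
\<close>

lemma three_powr_local_bound:
  assumes "k \<ge> 2"
  defines "l \<equiv> critical_exponent_bound k" and "s \<equiv> tail_exponent k"
  shows "3 powr (- l) + 3 powr (l - s) \<le> 1"
proof -
  define L where "L = ln (real (nth_prime k))"
  define t where "t = l * ln 3"
  define v where "v = exp t"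
  have v: "3 powr l = v" by (simp add: v_def t_def powr_def)
  have L: "L > 0" "L \<ge> ln 3"
    using ln_nth_prime_pos nth_prime_ge_three[OF assms(1)] by (auto simp: L_def)
  have l: "l = 3 / 2 / L" by (simp add: l_def critical_exponent_bound_def L_def)
  have ln3: "ln 3 \<ge> (1 :: real)" using exp_le by (subst ln_ge_iff) auto
  have "l > 0" unfolding l_def by (rule critical_exponent_bound_pos)
  have t: "t > 0" "t \<le> 3 / 2"
    using \<open>l > 0\<close> ln3 mult_left_mono[of "ln 3" L l] L l by (auto simp: t_def)
  have "v \<ge> 1" using t by (simp add: v_def)
  have "v > 0" by (simp add: v_def)
  have goal_eq: "3 powr (- l) + 3 powr (l - s) = 1 / v + v * 3 powr (- s)"
    by (simp add: powr_diff powr_minus v field_simps)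
  show ?thesis
  proof (cases "v \<ge> 6 / 5")
    case True
    have "exp (3 / 2 :: real) ^ 2 = exp 1 ^ 3" by (simp flip: exp_of_nat_mult)
    also have "\<dots> \<le> 3 ^ 3" using exp_le by (intro power_mono) auto
    also have "\<dots> \<le> (6 ^ 2 :: real)" by simp
    finally have "exp (3 / 2 :: real) \<le> 6" by (rule power2_le_imp_le) simp
    hence "v \<le> 6" using t order_trans[of v "exp (3 / 2)"] by (simp add: v_def)
    have "(36 / 5 :: real) \<le> 3 powr (11 / 6)"
      using le_powr_of_power_le[of 3 6 "36 / 5" 11] by (simp add: power_divide)
    also have "\<dots> \<le> 3 powr s" using tail_exponent_ge(1)[of k] assms by (intro powr_mono) auto
    finally have "3 powr (- s) \<le> 5 / 36" by (simp add: powr_minus field_simps)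
    hence "1 / v + v * 3 powr (- s) \<le> 1 / v + v * (5 / 36)"
      using \<open>v > 0\<close> by (intro add_left_mono mult_left_mono) auto
    also have "\<dots> \<le> 1"
    proof -
      have "(v - 6 / 5) * (v - 6) \<le> 0" using True \<open>v \<le> 6\<close> by (intro mult_nonneg_nonpos) auto
      thus ?thesis using \<open>v > 0\<close> by (simp add: field_simps)
    qed
    finally show ?thesis unfolding goal_eq .
  next
    case False
    have "1 + t \<le> v" unfolding v_def by (rule exp_ge_add_one_self)
    hence "t < 1 / 5" using False by simp
    hence "L > 15 / 2" using l ln3 L by (simp add: t_def field_simps)
    have large: "nth_prime k \<ge> 195"
    proof -
      have "(195 :: real) \<le> (27 / 10) ^ 6" by (simp add: power_divide)
      also have "\<dots> \<le> exp 1 ^ 6" using exp_one_ge by (intro power_mono) auto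
      also have "\<dots> = exp 6" by (simp flip: exp_of_nat_mult)
      also have "\<dots> \<le> exp L" using \<open>L > 15 / 2\<close> by simp
      also have "\<dots> = real (nth_prime k)"
        using prime_gt_0_nat[OF prime_nth_prime[of k]] by (simp add: L_def)
      finally show ?thesis by simp
    qed
    have "L\<^sup>2 \<le> 3 / 2 * (real k + 1)"
      unfolding L_def using assms large by (intro ln_nth_prime_squared_le) auto
    hence sl: "3 / 4 \<le> s * l" using L
      by (simp add: s_def tail_exponent_def l_def[symmetric] l power2_eq_square field_simps)
    \<comment> \<open>Now \<open>exp y \<ge> (27/10) y\<close> at \<open>y = s * ln 3 \<ge> 3 / (4 t)\<close> makes \<open>3 powr (- s)\<close> at most
      a multiple of \<open>t \<le> v - 1\<close>.\<close>
    have "3 / 4 \<le> s * ln 3 * t"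
    proof -
      have "3 / 4 * 1 \<le> (s * l) * (ln 3 * ln 3)"
        using sl ln3 mult_mono[of 1 "ln 3 :: real" 1 "ln 3"] by (intro mult_mono) auto
      thus ?thesis by (simp add: t_def mult_ac)
    qed
    hence "27 / 10 * (3 / 4) \<le> 27 / 10 * (s * ln 3 * t)" by (intro mult_left_mono) auto
    also have "\<dots> = 27 / 10 * (s * ln 3) * t" by (simp only: mult.assoc)
    also have "\<dots> \<le> exp (s * ln 3) * t"
      using exp_ge_27_10_mult[of "s * ln 3"] t by (intro mult_right_mono) auto
    finally have "3 powr (- s) \<le> t * (40 / 81)"
      by (simp add: powr_def exp_minus field_simps)
    hence "v * v * 3 powr (- s) \<le> (6 / 5 * (6 / 5)) * (t * (40 / 81))"
      using False \<open>v > 0\<close> t by (intro mult_mono) auto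
    also have "\<dots> \<le> v - 1" using \<open>1 + t \<le> v\<close> t by simp
    finally have "1 / v + v * 3 powr (- s) \<le> 1" using \<open>v > 0\<close> by (simp add: field_simps)
    thus ?thesis unfolding goal_eq .
  qed
qed

text \<open>
  The left-hand side bounds the total weight charged to a prime \<open>p\<close>: the first summand accounts
  for one member with a private power \<open>p ^ e\<close>, \<open>e \<ge> 2\<close>, and the second for all members with a
  private divisor \<open>p * d\<close> that is not a prime power. Division by \<open>p powr (- l)\<close> leaves an expression that decreases in
  \<open>p\<close>, so \<open>p = 3\<close> is the worst case. For \<open>k = 1\<close> the exponents \<open>l\<close> and \<open>s\<close> coincide and
  nothing is gained from the factor \<open>p powr (l - s)\<close>, but then \<open>s \<ge> 2\<close> and the sum over
  \<open>d\<close> is at most \<open>3/4\<close>.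
\<close>

lemma local_bound:
  assumes k: "k \<ge> 1" and p: "p \<ge> 3" and T: "finite T" "T \<subseteq> {2..}"
  defines "l \<equiv> critical_exponent_bound k" and "s \<equiv> tail_exponent k"
  shows "real p powr (- (2 * l)) + real p powr (- s) * (\<Sum>d\<in>T. real d powr (- s))
    \<le> real p powr (- l)"
proof -
  define Z where "Z = (\<Sum>d\<in>T. real d powr (- s))"
  have ls: "0 < l" "l \<le> s" "11 / 6 \<le> s"
    using critical_exponent_bound_pos tail_exponent_ge[OF k] by (auto simp: l_def s_def)
  have Z: "0 \<le> Z" "Z \<le> 1"
    using sum_powr_tail_le_one[of s T] ls T by (auto simp: Z_def intro: sum_nonneg)
  have mono: "real p powr a \<le> 3 powr a" if "a \<le> 0" for a
    using powr_mono2'[of a 3 "real p"] that p by simp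
  have "real p powr (- l) + real p powr (l - s) * Z \<le> 3 powr (- l) + 3 powr (l - s) * Z"
    using mono[of "- l"] mono[of "l - s"] ls Z by (intro add_mono mult_right_mono) auto
  also have "\<dots> \<le> 1"
  proof (cases "k \<ge> 2")
    case True
    have "3 powr (l - s) * Z \<le> 3 powr (l - s) * 1" using Z by (intro mult_left_mono) auto
    thus ?thesis using three_powr_local_bound[OF True, folded l_def s_def] by linarith
  next
    case False
    hence k1: "k = 1" using k by simp
    have "exp (3 / 4 :: real) \<ge> 2"
      using exp_lower_Taylor_quadratic[of "3 / 4 :: real"] by (simp add: power2_eq_square)
    hence "ln 2 \<le> (3 / 4 :: real)" by (metis exp_gt_zero ln_exp ln_le_cancel_iff zero_less_numeral)
    hence "l \<ge> 2" by (simp add: l_def critical_exponent_bound_def k1 nth_prime_one[simplified] field_simps)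
    moreover have "s = l" by (simp add: s_def l_def tail_exponent_def k1)
    ultimately have "Z \<le> 3 / 4" using sum_powr_tail_le_three_quarters[of s T] T by (simp add: Z_def)
    moreover have "3 powr (- l) \<le> 3 powr (- 2 :: real)" using \<open>l \<ge> 2\<close> by (intro powr_mono) auto
    ultimately show ?thesis using \<open>s = l\<close> by (simp add: powr_minus)
  qed
  finally have "real p powr (- l) * (real p powr (- l) + real p powr (l - s) * Z) \<le> real p powr (- l) * 1"
    by (intro mult_left_mono) auto
  also have "real p powr (- l) * (real p powr (- l) + real p powr (l - s) * Z)
      = real p powr (- l) * real p powr (- l) + real p powr (- l) * real p powr (l - s) * Z"
    by (simp only: distrib_left mult.assoc)
  also have "\<dots> = real p powr (- (2 * l)) + real p powr (- s) * Z"
    by (simp flip: powr_add)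
  finally show ?thesis by (simp add: Z_def)
qed

section \<open>Charging each member to a prime\<close>

lemma powr_le_of_power_le_square:
  assumes "D ^ (k + 1) \<le> n\<^sup>2" "D > 0" "n > 0"
  shows "real n powr (- critical_exponent_bound k) \<le> real D powr (- tail_exponent k)"
proof -
  have "real D powr ((real k + 1) / 2) = real (D ^ (k + 1)) powr (1 / 2)"
  proof -
    have "real (D ^ (k + 1)) = real D powr (real k + 1)"
      using \<open>D > 0\<close> powr_realpow[of "real D" "k + 1"] by (simp only: of_nat_power of_nat_add of_nat_1 of_nat_0_less_iff)
    thus ?thesis by (simp only: powr_powr times_divide_eq_right mult_1_right)
  qed
  also have "\<dots> \<le> real (n\<^sup>2) powr (1 / 2)"
    using assms(1) by (intro powr_mono2) (auto simp only: of_nat_le_iff)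
  also have "\<dots> = real n" using \<open>n > 0\<close> by (simp add: powr_half_sqrt)
  finally have "real n powr (- critical_exponent_bound k)
      \<le> (real D powr ((real k + 1) / 2)) powr (- critical_exponent_bound k)"
    using critical_exponent_bound_pos[of k] \<open>D > 0\<close> by (intro powr_mono2') auto
  thus ?thesis by (simp add: powr_powr tail_exponent_def mult_ac)
qed

text \<open>
  Here \<open>S\<close> stands for the members charged to \<open>p\<close>, and \<open>D n\<close> for the private divisor of \<open>n\<close>,
  whose largest prime factor is \<open>p\<close>. Since private divisors do not divide one another, at most one of
  them is a power of \<open>p\<close>, and if it is \<open>p\<close> itself, then nothing else is charged to \<open>p\<close>.
  The remaining ones are \<open>D n = p * h n\<close> with distinct cofactors \<open>h n \<ge> 2\<close>, and they exist only
  for \<open>p \<ge> 3\<close>, because a number with largest prime factor \<open>2\<close> is a power of \<open>2\<close>.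
\<close>

lemma sum_fibre_le:
  fixes S :: "nat set" and D :: "nat \<Rightarrow> nat" and p k :: nat
  assumes k: "k \<ge> 1" and S: "finite S" and p: "prime p"
    and dvd: "\<And>n. n \<in> S \<Longrightarrow> n > 0 \<and> D n dvd n"
    and antichain: "\<And>m n. m \<in> S \<Longrightarrow> n \<in> S \<Longrightarrow> D m dvd D n \<Longrightarrow> m = n"
    and p_dvd: "\<And>n. n \<in> S \<Longrightarrow> p dvd D n"
    and p_max: "\<And>n q. n \<in> S \<Longrightarrow> prime q \<Longrightarrow> q dvd D n \<Longrightarrow> q \<le> p"
    and small: "\<And>n. n \<in> S \<Longrightarrow> (\<exists>q e. prime q \<and> D n = q ^ e) \<or> D n ^ (k + 1) \<le> n\<^sup>2"
  defines "l \<equiv> critical_exponent_bound k"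
  shows "(\<Sum>n\<in>S. real n powr (- l)) \<le> real p powr (- l)"
proof (cases "\<exists>m\<in>S. D m = p")
  case True
  then obtain m where m: "m \<in> S" "D m = p" by blast
  have "n = m" if "n \<in> S" for n
    using antichain[OF m(1) that] p_dvd[OF that] m(2) by simp
  hence "S = {m}" using m(1) by blast
  moreover have "p \<le> m" using dvd[of m] m by (auto intro: dvd_imp_le)
  ultimately show ?thesis
    using critical_exponent_bound_pos[of k] prime_gt_0_nat[OF p]
    by (auto simp: l_def intro!: powr_mono2')
next
  case False
  define s where "s = tail_exponent k"
  define P where "P = {n \<in> S. \<exists>e. D n = p ^ e}"
  have "l > 0" unfolding l_def by (rule critical_exponent_bound_pos)
  have p1: "p > 1" by (rule prime_gt_1_nat[OF p])
  have D_pos: "D n > 0" if "n \<in> S" for n using dvd[OF that] by (auto intro: Nat.gr0I)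

  have P_sum: "(\<Sum>n\<in>P. real n powr (- l)) \<le> real p powr (- (2 * l))"
  proof (cases "P = {}")
    case True
    thus ?thesis by simp
  next
    case False
    then obtain m e where m: "m \<in> S" "D m = p ^ e" "m \<in> P" by (auto simp: P_def)
    have "n = m" if "n \<in> P" for n
    proof -
      obtain f where "n \<in> S" "D n = p ^ f" using \<open>n \<in> P\<close> by (auto simp: P_def)
      moreover have "p ^ e dvd p ^ f \<or> p ^ f dvd p ^ e"
        using le_imp_power_dvd[of e f p] le_imp_power_dvd[of f e p] by linarith
      ultimately show ?thesis using antichain m by metis
    qed
    hence "P = {m}" using m by blast
    have "e \<noteq> 0" using p_dvd[OF m(1)] m(2) p1 by (intro notI) simp
    moreover have "e \<noteq> 1" using \<open>\<not> (\<exists>m\<in>S. D m = p)\<close> m by (intro notI) simp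
    ultimately have "p\<^sup>2 \<le> p ^ e" using p1 by (intro power_increasing) auto
    also have "\<dots> \<le> m" using dvd[OF m(1)] m(2) by (auto intro: dvd_imp_le)
    finally have "real (p\<^sup>2) \<le> real m" by (simp only: of_nat_le_iff)
    hence "real m powr (- l) \<le> real (p\<^sup>2) powr (- l)"
      using \<open>l > 0\<close> p1 by (intro powr_mono2') auto
    also have "\<dots> = real p powr (- (2 * l))"
    proof -
      have "real (p\<^sup>2) = real p powr 2" using p1 by (simp add: powr_numeral)
      thus ?thesis by (simp only: powr_powr mult_minus_right)
    qed
    finally show ?thesis using \<open>P = {m}\<close> by simp
  qed

  show ?thesis
  proof (cases "P = S")
    case True
    have "real p powr (- (2 * l)) \<le> real p powr (- l)" using \<open>l > 0\<close> p1 by (intro powr_mono) auto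
    with P_sum True show ?thesis by simp
  next
    case False
    define h where "h n = D n div p" for n
    have Dh: "D n = p * h n" if "n \<in> S" for n using p_dvd[OF that] by (simp add: h_def)
    have h_ge: "h n \<ge> 2" if "n \<in> S" for n
    proof -
      have "h n \<noteq> 0" using Dh[OF that] D_pos[OF that] by (intro notI) simp
      moreover have "h n \<noteq> 1" using Dh[OF that] that \<open>\<not> (\<exists>m\<in>S. D m = p)\<close> by (intro notI) simp
      ultimately show ?thesis by linarith
    qed
    have "p \<ge> 3"
    proof (rule ccontr)
      assume "\<not> p \<ge> 3"
      hence "p = 2" using p1 by simp
      obtain n where n: "n \<in> S" "n \<notin> P" using False by (auto simp: P_def)
      have "D n \<noteq> 0" using D_pos[OF n(1)] by simp
      then obtain m where m: "D n = p ^ multiplicity p (D n) * m" "\<not> p dvd m"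
        using multiplicity_decompose'[of "D n" p] p1 by (metis nat_dvd_1_iff_1 less_irrefl)
      have "m = 1"
      proof (rule ccontr)
        assume "m \<noteq> 1"
        then obtain q where q: "prime q" "q dvd m" using prime_factor_nat by blast
        hence "q dvd D n" using m(1) by (metis dvd_mult)
        hence "q \<le> 2" using p_max[OF n(1) q(1)] \<open>p = 2\<close> by simp
        hence "q = p" using prime_ge_2_nat[OF q(1)] \<open>p = 2\<close> by simp
        thus False using q m by simp
      qed
      thus False using m(1) n by (auto simp: P_def)
    qed
    have "inj_on h (S - P)"
      using antichain Dh by (intro inj_onI) (metis Diff_iff dvd_refl)
    have "(\<Sum>n\<in>S - P. real n powr (- l)) \<le> (\<Sum>n\<in>S - P. real p powr (- s) * real (h n) powr (- s))"
    proof (intro sum_mono)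
      fix n assume n: "n \<in> S - P"
      have "\<not> (\<exists>q e. prime q \<and> D n = q ^ e)"
      proof
        assume "\<exists>q e. prime q \<and> D n = q ^ e"
        then obtain q e where "prime q" "D n = q ^ e" by blast
        moreover have "p = q"
          using p_dvd[of n] n p calculation by (metis DiffD1 prime_dvd_power primes_dvd_imp_eq)
        ultimately show False using n by (auto simp: P_def)
      qed
      hence "D n ^ (k + 1) \<le> n\<^sup>2" using small n by blast
      hence "real n powr (- l) \<le> real (D n) powr (- s)"
        using dvd[of n] D_pos[of n] n powr_le_of_power_le_square by (simp add: l_def s_def)
      thus "real n powr (- l) \<le> real p powr (- s) * real (h n) powr (- s)"
        using Dh[of n] n by (simp add: powr_mult)
    qed
    also have "\<dots> = real p powr (- s) * (\<Sum>d\<in>h ` (S - P). real d powr (- s))"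
      using \<open>inj_on h (S - P)\<close> by (simp add: sum.reindex sum_distrib_left)
    finally have "(\<Sum>n\<in>P. real n powr (- l)) + (\<Sum>n\<in>S - P. real n powr (- l))
        \<le> real p powr (- (2 * l)) + real p powr (- s) * (\<Sum>d\<in>h ` (S - P). real d powr (- s))"
      using P_sum by linarith
    also have "\<dots> \<le> real p powr (- l)"
      unfolding l_def s_def using k \<open>p \<ge> 3\<close> S h_ge by (intro local_bound) auto
    also have "(\<Sum>n\<in>P. real n powr (- l)) + (\<Sum>n\<in>S - P. real n powr (- l))
        = (\<Sum>n\<in>S. real n powr (- l))"
      using S by (subst sum.subset_diff[of P S]) (auto simp: P_def)
    finally show ?thesis .
  qed
qed

theorem theorem2:
  fixes k :: nat and lam x :: real and A :: "nat set"
  assumes "k \<ge> 1"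
    and "lam \<ge> (3 / 2) / ln (real (nth_prime k))"
    and "k_primitive k A"
    and "x \<ge> 2"
  shows "(\<Sum>n\<in>{n \<in> A. real n \<le> x}. real n powr (- lam))
           \<le> (\<Sum>p\<in>{p::nat. prime p \<and> real p \<le> x}. real p powr (- lam))"
proof -
  define l where "l = critical_exponent_bound k"
  have lam: "lam \<ge> l" using assms(2) by (simp add: l_def critical_exponent_bound_def)
  define B where "B = {n \<in> A. real n \<le> x}"
  have fin: "finite {n::nat. real n \<le> x \<and> Q n}" for Q
    by (rule finite_subset[of _ "{..nat \<lfloor>x\<rfloor>}"]) (auto simp: le_nat_floor)
  have "finite B" using fin[of "\<lambda>n. n \<in> A"] by (simp add: B_def conj_commute)
  have B_gt: "n > 1" if "n \<in> B" for n
    using that assms(3) by (auto simp: B_def k_primitive_def)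
  define ok where "ok n d \<longleftrightarrow> d > 1 \<and> private_divisor A n d \<and>
      ((\<exists>q e. prime q \<and> d = q ^ e) \<or> d ^ (k + 1) \<le> n\<^sup>2)" for n d
  define D where "D n = (SOME d. ok n d)" for n
  have D: "D n > 1 \<and> private_divisor A n (D n) \<and>
      ((\<exists>q e. prime q \<and> D n = q ^ e) \<or> D n ^ (k + 1) \<le> n\<^sup>2)" if "n \<in> B" for n
  proof -
    have "n \<in> A" using that by (simp add: B_def)
    from private_divisor_prime_power_or_small[OF assms(3) this assms(1)]
    obtain d where "d > 1" "private_divisor A n d"
      "(\<exists>q e. prime q \<and> d = q ^ e) \<or> d ^ (k + 1) \<le> n\<^sup>2" .
    hence "ok n d" unfolding ok_def by (intro conjI)
    hence "\<exists>d. ok n d" ..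
    hence "ok n (D n)" unfolding D_def by (rule someI_ex)
    thus ?thesis by (simp only: ok_def)
  qed
  have antichain: "m = n" if "m \<in> B" "n \<in> B" "D m dvd D n" for m n
  proof -
    have "D n dvd n" using D[OF that(2)] by (simp add: private_divisor_def)
    with that(3) have "D m dvd n" by (rule dvd_trans)
    moreover have "n \<in> A" using that(2) by (simp add: B_def)
    moreover have "\<forall>a\<in>A. D m dvd a \<longrightarrow> a = m" using D[OF that(1)] by (simp add: private_divisor_def)
    ultimately have "n = m" by simp
    thus ?thesis ..
  qed
  define f where "f n = Max (prime_factors (D n))" for n
  have f: "prime (f n)" "f n dvd D n" "\<And>q. prime q \<Longrightarrow> q dvd D n \<Longrightarrow> q \<le> f n"
    if "n \<in> B" for n
  proof -
    have "D n > 1" using D[OF that] by blast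
    hence "prime_factors (D n) \<noteq> {}" by (auto simp: prime_factorization_empty_iff)
    hence "f n \<in> prime_factors (D n)" unfolding f_def by (intro Max_in) auto
    thus "prime (f n)" "f n dvd D n" by auto
    show "q \<le> f n" if "prime q" "q dvd D n" for q
      unfolding f_def using that \<open>D n > 1\<close> by (intro Max_ge) (auto simp: in_prime_factors_iff)
  qed
  have f_le: "f n \<le> n" if "n \<in> B" for n
    using f(2)[OF that] D[OF that] B_gt[OF that]
    by (intro dvd_imp_le) (auto simp: private_divisor_def intro: dvd_trans)

  have fibre: "(\<Sum>n\<in>{n \<in> B. f n = p}. real n powr (- lam)) \<le> real p powr (- lam)"
    if "p \<in> f ` B" for p
  proof -
    have p: "prime p" using that f(1) by auto
    have "(\<Sum>n\<in>{n \<in> B. f n = p}. real n powr (- lam))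
        \<le> (\<Sum>n\<in>{n \<in> B. f n = p}. real n powr (- l) * real p powr (- (lam - l)))"
    proof (intro sum_mono)
      fix n assume n: "n \<in> {n \<in> B. f n = p}"
      have "real n powr (- lam) = real n powr (- l) * real n powr (- (lam - l))"
        by (simp flip: powr_add)
      also have "\<dots> \<le> real n powr (- l) * real p powr (- (lam - l))"
        using lam f_le[of n] n prime_gt_0_nat[OF p]
        by (intro mult_left_mono powr_mono2') auto
      finally show "real n powr (- lam) \<le> real n powr (- l) * real p powr (- (lam - l))" .
    qed
    also have "\<dots> = (\<Sum>n\<in>{n \<in> B. f n = p}. real n powr (- l)) * real p powr (- (lam - l))"
      by (rule sum_distrib_right[symmetric])
    also have "\<dots> \<le> real p powr (- l) * real p powr (- (lam - l))"
    proof (intro mult_right_mono)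
      show "(\<Sum>n\<in>{n \<in> B. f n = p}. real n powr (- l)) \<le> real p powr (- l)"
        unfolding l_def
      proof (rule sum_fibre_le[where D = D, OF assms(1) _ p])
        fix n assume n: "n \<in> {n \<in> B. f n = p}"
        thus "n > 0 \<and> D n dvd n" using B_gt[of n] D[of n] by (auto simp: private_divisor_def)
        show "(\<exists>q e. prime q \<and> D n = q ^ e) \<or> D n ^ (k + 1) \<le> n\<^sup>2" using n D[of n] by blast
      qed (use \<open>finite B\<close> f antichain in auto)
    qed simp
    also have "\<dots> = real p powr (- lam)" by (simp flip: powr_add)
    finally show ?thesis .
  qed

  have "(\<Sum>n\<in>B. real n powr (- lam)) = (\<Sum>p\<in>f ` B. \<Sum>n\<in>{n \<in> B. f n = p}. real n powr (- lam))"
    using \<open>finite B\<close> by (rule sum.image_gen)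
  also have "\<dots> \<le> (\<Sum>p\<in>f ` B. real p powr (- lam))" by (intro sum_mono fibre)
  also have "\<dots> \<le> (\<Sum>p\<in>{p. prime p \<and> real p \<le> x}. real p powr (- lam))"
  proof (intro sum_mono2)
    show "finite {p::nat. prime p \<and> real p \<le> x}" using fin[of prime] by (simp add: conj_commute)
    show "f ` B \<subseteq> {p. prime p \<and> real p \<le> x}"
    proof
      fix p assume "p \<in> f ` B"
      then obtain n where n: "n \<in> B" "p = f n" by blast
      hence "real p \<le> real n" "real n \<le> x" using f_le[OF n(1)] by (simp_all add: B_def)
      thus "p \<in> {p. prime p \<and> real p \<le> x}" using f(1)[OF n(1)] n(2) by simp
    qed
  qed auto
  finally show ?thesis by (simp add: B_def)
qed

end
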